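(* Let $n\ge2$ be an integer, let $\ell=2m$ be an even integer with $2\le\ell<n+1$, and put $$M=(n+1)(n+3),\qquad q=\frac{n+1-\ell}{M},\qquad k=\frac1q.$$ Then the function $F_1$ has a simple zero at $q$. The meromorphic function $\mathcal K_n(s)=K_0(s)F_1(s)$ is holomorphic at $q$, and $$\mathcal K_n(q)\ne0\iff k\in\mathbb Z\ \text{and}\ n+4\le k\le 2n+3.$$ If this condition holds, put $j_0=2n+3-k$. Then $$\mathcal K_n(q)=\bigl(\operatorname*{Res}_{s=q}K_0(s)\bigr)F_1'(q),\qquad \operatorname{sgn}\mathcal K_n(q)=(-1)^{n-j_0+m}.$$ In every other case $\mathcal K_n$ has a simple zero at $q$.
   Context: The Selberg product (meromorphic in $a,b,c$) is $$S_n(a,b,c)=\prod_{j=0}^{n-1}\frac{\Gamma(a+jc)\,\Gamma(b+jc)\,\Gamma(1+(j+1)c)}{\Gamma(a+b+(n+j-1)c)\,\Gamma(1+c)},\qquad S_0=1.$$ The type $B/C$ reference period and finite connection factor are the meromorphic functions of $s$ $$K_0(s)=\frac1{n!}S_n\!\left(-\tfrac12+\bigl(n+\tfrac32\bigr)s,\;1-2s,\;-\tfrac s2\right),$$ $$F_1(s)=\sum_{p=0}^n\prod_{j=1}^p\rho_j(s),\qquad \rho_j(s)=-\frac{\sin((n-j+1)\theta)\cos((n+j+3)\theta)}{\sin(j\theta)\cos(j\theta)},\quad \theta=\frac{\pi s}2.$$ ($K_0$ is the meromorphic continuation of $\frac1{n!}\int_{(1,\infty)^n}\prod_i x_i^{a-1}|1-x_i|^{b-1}\prod_{i<j}|x_i-x_j|^{2c}\,dx$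 with $a=\frac{1-s}2$, $b=1-2s$, $c=-\frac s2$, and $\mathcal K_n=K_0F_1$ is the sum over $0\le p\le n$ of the analogous continued integrals $\frac1{p!(n-p)!}\int_{(0,1)^p\times(1,\infty)^{n-p}}$.) *)

theory Defs
  imports "HOL-Complex_Analysis.Complex_Analysis"
begin

definition selberg_product :: "nat \<Rightarrow> complex \<Rightarrow> complex \<Rightarrow> complex \<Rightarrow> complex" where
  "selberg_product n a b c =
     (\<Prod>j<n. (Gamma (a + of_nat j * c) * Gamma (b + of_nat j * c) * Gamma (1 + of_nat (j + 1) * c))
            / (Gamma (a + b + (of_nat n + of_nat j - 1) * c) * Gamma (1 + c)))"

text \<open>
  The formulas below determine meromorphic functions, but taken pointwise they give
  arbitrary values where a factor has a pole (\<open>Gamma\<close> and \<open>x / 0\<close> are then \<open>0\<close>), even if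
  the singularity cancels in the product. The normalisation
  \<^const>\<open>remove_sings\<close> replaces such values by the limit; at a genuine pole the value is \<open>0\<close>.
  No affine Gamma argument in \<open>K0\<close> is constant in \<open>s\<close>, so restricting the Selberg product
  to this line is harmless away from a discrete set.
\<close>

definition K0 :: "nat \<Rightarrow> complex \<Rightarrow> complex" where
  "K0 n = remove_sings (\<lambda>s. 1 / fact n *
     selberg_product n (- 1 / 2 + (of_nat n + 3 / 2) * s) (1 - 2 * s) (- s / 2))"

definition rho :: "nat \<Rightarrow> nat \<Rightarrow> complex \<Rightarrow> complex" where
  "rho n j s = (let \<theta> = of_real pi * s / 2 in
     - (sin ((of_nat n - of_nat j + 1) * \<theta>) * cos ((of_nat n + of_nat j + 3) * \<theta>))
       / (sin (of_nat j * \<theta>) * cos (of_nat j * \<theta>)))"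

definition F1 :: "nat \<Rightarrow> complex \<Rightarrow> complex" where
  "F1 n = remove_sings (\<lambda>s. \<Sum>p\<le>n. \<Prod>j=1..p. rho n j s)"

definition Kn :: "nat \<Rightarrow> complex \<Rightarrow> complex" where
  "Kn n = remove_sings (\<lambda>s. K0 n s * F1 n s)"

text \<open>
  \<^const>\<open>isolated_zero\<close> guarantees that \<^const>\<open>zorder\<close> is meaningful; both only look at a
  punctured neighbourhood, so the value at the point is required separately.
\<close>

definition simple_zero :: "(complex \<Rightarrow> complex) \<Rightarrow> complex \<Rightarrow> bool" where
  "simple_zero f z \<longleftrightarrow> f analytic_on {z} \<and> f z = 0 \<and> isolated_zero f z \<and> zorder f z = 1"

end

theory Submission
  imports Defs
begin

text \<open>
  Put \<open>\<theta> = \<pi> s / 2\<close> and \<open>M = (n + 1) (n + 3)\<close>. The statement rests on a product formula for the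
  connection factor: \<open>F\<^sub>1(s) sin ((2 n + 2) \<theta>) sin ((2 n + 6) \<theta>)\<close> equals
  \<open>2 sin (2 \<theta>) sin (3 \<theta>) (\<Prod>j=1..n. sin ((j + 3) \<theta>) / cos (j \<theta>)) cos (M \<theta> - n \<pi> / 2)\<close>
  (\<open>conn_sum_closed_form\<close>). At \<open>s = q\<close> all sines and cosines are positive except the last cosine,
  whose argument is \<open>\<pi> / 2 - m \<pi>\<close>. So \<open>F\<^sub>1\<close> has a simple zero at \<open>q\<close>, and its derivative there
  has the sign \<open>(-1) ^ (m + 1)\<close>.

  The formula does not come from a single summation theorem. For the base
  \<open>Q = exp (2 \<i> \<theta>)\<close>, \<open>F\<^sub>1\<close> is the value at \<open>w = 1\<close> of a terminating basic hypergeometric series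
  \<open>\<Sum>p\<le>n. t\<^sub>p w\<^sup>p\<close>, whereas the \<open>q\<close>-Chu--Vandermonde sum (\<open>q_chu_vandermonde\<close>) evaluates it at
  \<open>w = Q ^ 2\<close> and, by the symmetry \<open>\<theta> \<mapsto> -\<theta>\<close>, at \<open>w = 1 / Q ^ 2\<close>. The
  second-order \<open>q\<close>-difference equation of the series (\<open>conn_sum_recurrence\<close>) connects these two
  values with the one at \<open>w = 1\<close>. The two values are one and the same product with two opposite
  phases of frequency quadratic in \<open>n\<close>, and combining them produces \<open>cos (M \<theta> - n \<pi> / 2)\<close>.

  For the reference period, \<open>0 < q < 1 / (n + 3)\<close> keeps all Gamma arguments in \<open>K\<^sub>0\<close> at \<open>q\<close> positive,
  except those of \<open>\<Gamma>(((2 n + 3 - j) s - 1) / 2)\<close> for \<open>j < n\<close>, which lie in \<open>(-1/2, 1/2)\<close>. Hence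
  \<open>K\<^sub>0\<close> is regular and nonzero at \<open>q\<close> unless \<open>(2 n + 3 - j) q = 1\<close> for some \<open>j\<close>, that is,
  unless \<open>k = 2 n + 3 - j\<close> is an integer with \<open>n + 4 \<le> k \<le> 2 n + 3\<close>. In that case \<open>j = j\<^sub>0\<close>, the
  pole is simple, and its residue has the sign \<open>(-1) ^ (n - 1 - j\<^sub>0)\<close> because the factors with
  larger index are negative (\<open>K0_simple_pole\<close>). In the regular case the product \<open>K\<^sub>0 F\<^sub>1\<close> inherits
  the simple zero; at a pole its value is residue times derivative, with the product of the two signs.
\<close>

section \<open>The q-Chu--Vandermonde sum\<close>

text \<open>The \<open>q\<close>-shifted factorial, usually written \<open>(x; q)\<^sub>n\<close>.\<close>

definition qpoch :: "'a::field \<Rightarrow> 'a \<Rightarrow> nat \<Rightarrow> 'a" where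
  "qpoch q x n = (\<Prod>j<n. 1 - x * q ^ j)"

lemma qpoch_0 [simp]: "qpoch q x 0 = 1"
  by (simp add: qpoch_def)

lemma qpoch_Suc: "qpoch q x (Suc n) = qpoch q x n * (1 - x * q ^ n)"
  by (simp add: qpoch_def)

lemma qpoch_Suc': "qpoch q x (Suc n) = (1 - x) * qpoch q (x * q) n"
  unfolding qpoch_def by (subst prod.lessThan_Suc_shift) (simp add: mult.assoc)

lemma qpoch_eq_0_iff: "qpoch q x n = 0 \<longleftrightarrow> (\<exists>j<n. x * q ^ j = 1)"
  by (auto simp: qpoch_def)

text \<open>
  The terminating series \<open>\<^sub>2\<phi>\<^sub>1(1 / q ^ n, b; c; q, q)\<close>. Replacing \<open>n\<close> by \<open>n + 1\<close> changes
  only the factor \<open>(1 / q ^ n; q)\<^sub>p\<close>, and the difference of the two factors is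
  \<open>(1 / q ^ n; q)\<^sub>p\<^sub>-\<^sub>1 (q ^ p - 1) / q ^ (n + 1)\<close>, which cancels the last factor of \<open>(q; q)\<^sub>p\<close>.
  Hence the sum for \<open>n + 1\<close> and \<open>(b, c)\<close> is the sum for \<open>n\<close> and \<open>(b, c)\<close> minus a multiple of the sum for \<open>n\<close> and \<open>(b q, c q)\<close>. The quotient \<open>c / b\<close> is the same in both, so
  the two closed forms differ by an elementary factor and combine.
\<close>
lemma q_chu_vandermonde:
  fixes q b c :: "'a::field"
  assumes "q \<noteq> 0" "b \<noteq> 0"
    and "\<And>j. j < n \<Longrightarrow> c * q ^ j \<noteq> 1" and "\<And>j. 0 < j \<Longrightarrow> j \<le> n \<Longrightarrow> q ^ j \<noteq> 1"
  shows "(\<Sum>p\<le>n. qpoch q (1 / q ^ n) p * qpoch q b p / (qpoch q c p * qpoch q q p) * q ^ p)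
    = qpoch q (c / b) n * b ^ n / qpoch q c n"
  using assms(2-)
proof (induction n arbitrary: b c)
  case 0
  show ?case by simp
next
  case (Suc n b c)
  define A where "A = (\<lambda>n b c p. qpoch q (1 / q ^ n) p * qpoch q b p / (qpoch q c p * qpoch q q p))"
  have c1: "1 - c \<noteq> 0" using Suc.prems(2)[of 0] by simp
  \<comment> \<open>The analogue of Pascal's rule for the coefficients, from the difference of the first
     \<open>q\<close>-factorials.\<close>
  have pascal: "A (Suc n) b c (Suc p) = A n b c (Suc p)
      - (1 - b) / ((1 - c) * q ^ Suc n) * A n (b * q) (c * q) p" if "p \<le> n" for p
  proof -
    have nz: "1 - q * q ^ p \<noteq> 0"
      using Suc.prems(3)[of "Suc p"] that by simp
    have u: "qpoch q (1 / q ^ Suc n) (Suc p) = (1 - 1 / q ^ Suc n) * qpoch q (1 / q ^ n) p"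
      using assms(1) by (simp add: qpoch_Suc' field_simps)
    have v: "qpoch q (1 / q ^ n) (Suc p) = qpoch q (1 / q ^ n) p * (1 - q ^ p / q ^ n)"
      by (simp add: qpoch_Suc)
    have d: "qpoch q (1 / q ^ Suc n) (Suc p) - qpoch q (1 / q ^ n) (Suc p)
        = - (1 - q * q ^ p) / q ^ Suc n * qpoch q (1 / q ^ n) p"
      unfolding u v using assms(1) by (simp add: field_simps)
    have "A (Suc n) b c (Suc p) - A n b c (Suc p) =
        (qpoch q (1 / q ^ Suc n) (Suc p) - qpoch q (1 / q ^ n) (Suc p)) * qpoch q b (Suc p)
         / (qpoch q c (Suc p) * qpoch q q (Suc p))"
      by (simp add: A_def diff_divide_distrib left_diff_distrib)
    also have "\<dots> = - ((1 - b) / ((1 - c) * q ^ Suc n) * A n (b * q) (c * q) p)"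
      unfolding d A_def qpoch_Suc[of q q] qpoch_Suc'[of q b] qpoch_Suc'[of q c]
    proof -
      have "- X / Y * a * ((1 - b) * B) / ((1 - c) * C * (D * X))
          = - ((1 - b) / ((1 - c) * Y) * (a * B / (C * D)))" if "X \<noteq> 0" for X Y a B C D :: 'a
        using that by (simp add: divide_inverse)
      from this[OF nz] show "- (1 - q * q ^ p) / q ^ Suc n * qpoch q (1 / q ^ n) p * ((1 - b) * qpoch q (b * q) p)
          / ((1 - c) * qpoch q (c * q) p * (qpoch q q p * (1 - q * q ^ p)))
        = - ((1 - b) / ((1 - c) * q ^ Suc n)
            * (qpoch q (1 / q ^ n) p * qpoch q (b * q) p / (qpoch q (c * q) p * qpoch q q p)))" .
    qed
    finally show ?thesis by (simp add: algebra_simps)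
  qed
  have top: "A n b c (Suc n) = 0"
    using assms(1) by (simp add: A_def qpoch_Suc)
  have IH: "(\<Sum>p\<le>n. A n b c p * q ^ p) = qpoch q (c / b) n * b ^ n / qpoch q c n"
    unfolding A_def using Suc.prems by (intro Suc.IH) auto
  have IH': "(\<Sum>p\<le>n. A n (b * q) (c * q) p * q ^ p)
      = qpoch q (c / b) n * (b * q) ^ n / qpoch q (c * q) n"
  proof -
    have "(\<Sum>p\<le>n. A n (b * q) (c * q) p * q ^ p)
      = qpoch q ((c * q) / (b * q)) n * (b * q) ^ n / qpoch q (c * q) n"
      unfolding A_def
    proof (intro Suc.IH)
      show "c * q * q ^ j \<noteq> 1" if "j < n" for j
        using Suc.prems(2)[of "Suc j"] that by (simp add: mult.assoc)
    qed (use Suc.prems assms(1) in auto)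
    then show ?thesis using assms(1) by simp
  qed
  have q0: "A (Suc n) b c 0 = A n b c 0" by (simp add: A_def)
  have "(\<Sum>p\<le>Suc n. A (Suc n) b c p * q ^ p)
      = A n b c 0 + (\<Sum>p\<le>n. A n b c (Suc p) * q ^ Suc p)
        - (1 - b) / ((1 - c) * q ^ Suc n) * q * (\<Sum>p\<le>n. A n (b * q) (c * q) p * q ^ p)"
  proof -
    have "(\<Sum>p\<le>n. A (Suc n) b c (Suc p) * q ^ Suc p)
        = (\<Sum>p\<le>n. A n b c (Suc p) * q ^ Suc p
            - (1 - b) / ((1 - c) * q ^ Suc n) * q * (A n (b * q) (c * q) p * q ^ p))"
      by (intro sum.cong refl) (simp add: pascal algebra_simps)
    then show ?thesis
      by (subst sum.atMost_Suc_shift) (simp add: q0 sum_subtractf sum_distrib_left)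
  qed
  also have "A n b c 0 + (\<Sum>p\<le>n. A n b c (Suc p) * q ^ Suc p) = (\<Sum>p\<le>Suc n. A n b c p * q ^ p)"
    by (subst sum.atMost_Suc_shift) simp
  also have "\<dots> = (\<Sum>p\<le>n. A n b c p * q ^ p)"
    by (simp add: top)
  also have "(\<Sum>p\<le>n. A n b c p * q ^ p)
      - (1 - b) / ((1 - c) * q ^ Suc n) * q * (\<Sum>p\<le>n. A n (b * q) (c * q) p * q ^ p)
    = qpoch q (c / b) (Suc n) * b ^ Suc n / qpoch q c (Suc n)"
  proof -
    have e: "qpoch q c n * (1 - c * q ^ n) = (1 - c) * qpoch q (c * q) n"
      using qpoch_Suc[of q c n] qpoch_Suc'[of q c n] by simp
    have ne: "qpoch q c (Suc n) \<noteq> 0"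
      unfolding qpoch_eq_0_iff using Suc.prems(2) by blast
    from ne have nz: "qpoch q c n \<noteq> 0" "1 - c * q ^ n \<noteq> 0"
      by (simp_all add: qpoch_Suc)
    from ne have nz': "qpoch q (c * q) n \<noteq> 0"
      by (simp add: qpoch_Suc')
    have f: "1 / qpoch q c n = (1 - c * q ^ n) / qpoch q c (Suc n)"
      using nz by (simp add: qpoch_Suc)
    have second: "(1 - b) / ((1 - c) * q ^ Suc n) * q * (qpoch q (c / b) n * (b * q) ^ n / qpoch q (c * q) n)
       = (1 - b) * qpoch q (c / b) n * b ^ n / qpoch q c (Suc n)"
      using assms(1) c1 nz' by (simp add: qpoch_Suc' power_mult_distrib field_simps)
    have first: "qpoch q (c / b) n * b ^ n / qpoch q c n
       = (1 - c * q ^ n) * qpoch q (c / b) n * b ^ n / qpoch q c (Suc n)"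
    proof -
      have "qpoch q (c / b) n * b ^ n / qpoch q c n = qpoch q (c / b) n * b ^ n * (1 / qpoch q c n)"
        by simp
      then show ?thesis unfolding f by (simp add: mult_ac)
    qed
    have "(1 - c * q ^ n) * qpoch q (c / b) n * b ^ n - (1 - b) * qpoch q (c / b) n * b ^ n
        = qpoch q (c / b) n * (1 - c / b * q ^ n) * b ^ Suc n"
      using Suc.prems(1) by (simp add: field_simps)
    then show ?thesis
      unfolding IH IH' first second diff_divide_distrib[symmetric] qpoch_Suc[of q "c / b"]
      by (simp only:)
  qed
  finally show ?case by (simp add: A_def)
qed

section \<open>The connection factor as a terminating series\<close>

text \<open>
  With \<open>q = exp (2 \<i> \<theta>)\<close> the product \<open>\<rho>\<^sub>1 \<cdots> \<rho>\<^sub>p\<close> is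
  \<open>(1 / q ^ n; q)\<^sub>p (b; q)\<^sub>p / ((-q; q)\<^sub>p (q; q)\<^sub>p q ^ p)\<close> for \<open>b = - q ^ (n + 4)\<close>. It is kept in
  trigonometric form, in which it is visibly even in \<open>\<theta>\<close>.
\<close>
definition conn_term :: "nat \<Rightarrow> complex \<Rightarrow> nat \<Rightarrow> complex" where
  "conn_term n \<theta> p = (\<Prod>j=1..p.
     - (sin ((of_nat n - of_nat j + 1) * \<theta>) * cos ((of_nat n + of_nat j + 3) * \<theta>))
       / (sin (of_nat j * \<theta>) * cos (of_nat j * \<theta>)))"

text \<open>
  The free variable \<open>w\<close> makes the sums at \<open>w = q\<^sup>k\<close> available; the connection factor is the value
  at \<open>w = 1\<close>.
\<close>
definition conn_sum :: "nat \<Rightarrow> complex \<Rightarrow> complex \<Rightarrow> complex" where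
  "conn_sum n \<theta> w = (\<Sum>p\<le>n. conn_term n \<theta> p * w ^ p)"

lemma conn_term_uminus: "conn_term n (- \<theta>) p = conn_term n \<theta> p"
  by (simp add: conn_term_def)

text \<open>
  Doubling the angle in the denominator of \<open>\<rho>\<^sub>p\<^sub>+\<^sub>1\<close> and writing its numerator as a difference of
  sines separates the dependence on \<open>p\<close> from that on \<open>n\<close>. The right-hand side vanishes for
  \<open>p = n\<close>, which is what terminates the series.
\<close>
lemma conn_term_Suc:
  assumes "sin (of_nat (Suc p) * \<theta>) \<noteq> 0" "cos (of_nat (Suc p) * \<theta>) \<noteq> 0"
  shows "conn_term n \<theta> (Suc p) * sin (2 * of_nat (Suc p) * \<theta>)
    = (sin ((2 * of_nat p + 4) * \<theta>) - sin ((2 * of_nat n + 4) * \<theta>)) * conn_term n \<theta> p"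
proof -
  let ?a = "(of_nat n - of_nat p) * \<theta>" and ?b = "(of_nat n + of_nat p + 4) * \<theta>"
  have step: "conn_term n \<theta> (Suc p) = conn_term n \<theta> p *
     (- (sin ?a * cos ?b) / (sin (of_nat (Suc p) * \<theta>) * cos (of_nat (Suc p) * \<theta>)))"
    by (simp add: conn_term_def add_ac)
  have double: "sin (2 * of_nat (Suc p) * \<theta>) = 2 * sin (of_nat (Suc p) * \<theta>) * cos (of_nat (Suc p) * \<theta>)"
    using sin_double[of "of_nat (Suc p) * \<theta>"] by (simp only: mult.assoc)
  have product: "2 * (sin ?a * cos ?b) = sin ((2 * of_nat n + 4) * \<theta>) - sin ((2 * of_nat p + 4) * \<theta>)"
  proof -
    have "?a + ?b = (2 * of_nat n + 4) * \<theta>" "?a - ?b = - ((2 * of_nat p + 4) * \<theta>)"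
      by (simp_all add: algebra_simps)
    then show ?thesis
      by (simp only: sin_times_cos sin_minus) simp
  qed
  have cancel: "t * (- u / (s * c)) * (2 * s * c) = - (2 * u) * t"
    if "s \<noteq> 0" "c \<noteq> 0" for t u s c :: complex
    using that by simp
  show ?thesis
    unfolding step double cancel[OF assms] product by (simp only: minus_diff_eq)
qed

lemma exp_diff_eq_sin: "exp (\<i> * z) - exp (- (\<i> * z)) = 2 * \<i> * sin (z::complex)"
  by (simp add: sin_exp_eq')

text \<open>
  The second-order \<open>q\<close>-difference equation of the series in \<open>w\<close>, obtained by summing the recursion
  for the terms against \<open>x ^ (p + 1)\<close>: the sines in \<open>p\<close> are differences of powers of \<open>q\<close>, hence
  shifts of the argument by \<open>q\<close> and \<open>1 / q\<close>.
\<close>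
lemma conn_sum_recurrence:
  fixes \<theta> x :: complex
  defines "q \<equiv> exp (2 * \<i> * \<theta>)"
  assumes "\<And>j. 1 \<le> j \<Longrightarrow> j \<le> n \<Longrightarrow> sin (of_nat j * \<theta>) \<noteq> 0 \<and> cos (of_nat j * \<theta>) \<noteq> 0"
  shows "(1 - q\<^sup>2 * x) * conn_sum n \<theta> (q * x) - (1 - x / q\<^sup>2) * conn_sum n \<theta> (x / q)
    = - (2 * \<i> * sin ((2 * of_nat n + 4) * \<theta>)) * x * conn_sum n \<theta> x"
proof -
  have q0: "q \<noteq> 0" by (simp add: q_def)
  have qp: "q ^ p = exp (\<i> * (2 * of_nat p * \<theta>))" for p
    by (simp add: q_def exp_of_nat_mult[symmetric] algebra_simps)
  have qs: "q ^ p - 1 / q ^ p = 2 * \<i> * sin (2 * of_nat p * \<theta>)" for p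
    unfolding qp exp_diff_eq_sin[symmetric] by (simp add: exp_minus divide_inverse)
  let ?s = "\<lambda>p::nat. sin (2 * of_nat p * \<theta>)" and ?\<sigma> = "sin ((2 * of_nat n + 4) * \<theta>)"
  have "(\<Sum>p\<le>n. conn_term n \<theta> p * ?s p * x ^ p)
      = (\<Sum>p\<in>{..<n}. conn_term n \<theta> (Suc p) * ?s (Suc p) * x ^ Suc p)"
    by (subst sum.atMost_shift) simp
  also have "\<dots> = (\<Sum>p<n. x * ((?s (p + 2) - ?\<sigma>) * conn_term n \<theta> p * x ^ p))"
  proof (rule sum.cong)
    fix p assume "p \<in> {..<n}"
    then have "conn_term n \<theta> (Suc p) * ?s (Suc p)
        = (sin ((2 * of_nat p + 4) * \<theta>) - ?\<sigma>) * conn_term n \<theta> p"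
      using assms(2)[of "Suc p"] by (intro conn_term_Suc) auto
    also have "sin ((2 * of_nat p + 4) * \<theta>) = ?s (p + 2)"
      by (simp add: algebra_simps)
    finally show "conn_term n \<theta> (Suc p) * ?s (Suc p) * x ^ Suc p
        = x * ((?s (p + 2) - ?\<sigma>) * conn_term n \<theta> p * x ^ p)"
      by (simp only: power_Suc mult_ac)
  qed simp
  also have "\<dots> = (\<Sum>p\<le>n. x * ((?s (p + 2) - ?\<sigma>) * conn_term n \<theta> p * x ^ p))"
    by (simp add: lessThan_Suc_atMost[symmetric] add.commute)
  finally have shifted: "(\<Sum>p\<le>n. conn_term n \<theta> p * ?s p * x ^ p)
      = (\<Sum>p\<le>n. x * ((?s (p + 2) - ?\<sigma>) * conn_term n \<theta> p * x ^ p))" .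
  have "(\<Sum>p\<le>n. conn_term n \<theta> p * (2 * \<i> * ?s p) * x ^ p)
      = 2 * \<i> * (\<Sum>p\<le>n. conn_term n \<theta> p * ?s p * x ^ p)"
    unfolding sum_distrib_left by (intro sum.cong refl) (simp only: mult_ac)
  also have "\<dots> = (\<Sum>p\<le>n. x * ((2 * \<i> * ?s (p + 2) - 2 * \<i> * ?\<sigma>) * conn_term n \<theta> p * x ^ p))"
    unfolding shifted sum_distrib_left right_diff_distrib[symmetric]
    by (intro sum.cong refl) (simp only: mult_ac)
  finally have "(\<Sum>p\<le>n. conn_term n \<theta> p * (q ^ p - 1 / q ^ p) * x ^ p)
      = (\<Sum>p\<le>n. x * ((q ^ (p + 2) - 1 / q ^ (p + 2) - 2 * \<i> * ?\<sigma>) * conn_term n \<theta> p * x ^ p))"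
    by (simp only: qs)
  moreover have lhs: "(\<Sum>p\<le>n. conn_term n \<theta> p * (q ^ p - 1 / q ^ p) * x ^ p)
      = conn_sum n \<theta> (q * x) - conn_sum n \<theta> (x / q)"
    unfolding conn_sum_def sum_subtractf[symmetric]
    by (intro sum.cong refl) (simp add: power_mult_distrib power_divide field_simps)
  moreover have rhs: "(\<Sum>p\<le>n. x * ((q ^ (p + 2) - 1 / q ^ (p + 2) - 2 * \<i> * ?\<sigma>) * conn_term n \<theta> p * x ^ p))
      = x * q\<^sup>2 * conn_sum n \<theta> (q * x) - x / q\<^sup>2 * conn_sum n \<theta> (x / q)
        - 2 * \<i> * ?\<sigma> * x * conn_sum n \<theta> x"
    unfolding conn_sum_def sum_subtractf[symmetric] sum_distrib_left
    by (intro sum.cong refl) (simp add: power_mult_distrib power_divide power_add power2_eq_square field_simps q0)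
  ultimately have "conn_sum n \<theta> (q * x) - conn_sum n \<theta> (x / q)
      = x * q\<^sup>2 * conn_sum n \<theta> (q * x) - x / q\<^sup>2 * conn_sum n \<theta> (x / q)
        - 2 * \<i> * ?\<sigma> * x * conn_sum n \<theta> x"
    by (simp only: lhs rhs)
  then show ?thesis
    by (simp add: algebra_simps)
qed

lemma one_minus_exp: "1 - exp (2 * \<i> * z) = - 2 * \<i> * sin z * exp (\<i> * z)" for z :: complex
proof -
  have "2 * \<i> * sin z * exp (\<i> * z) = (exp (\<i> * z) - exp (- (\<i> * z))) * exp (\<i> * z)"
    by (simp only: exp_diff_eq_sin)
  also have "\<dots> = exp (2 * \<i> * z) - 1"
    by (simp add: left_diff_distrib exp_add[symmetric] algebra_simps)
  finally show ?thesis by simp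
qed

lemma one_plus_exp: "1 + exp (2 * \<i> * z) = 2 * cos z * exp (\<i> * z)" for z :: complex
proof -
  have "2 * cos z * exp (\<i> * z) = (exp (\<i> * z) + exp (- (\<i> * z))) * exp (\<i> * z)"
    by (simp add: cos_exp_eq)
  also have "\<dots> = 1 + exp (2 * \<i> * z)"
    by (simp add: distrib_right exp_add[symmetric] algebra_simps)
  finally show ?thesis by simp
qed

text \<open>
  At \<open>w = q ^ 2\<close> the factor \<open>1 / q ^ p\<close> of the terms turns \<open>w ^ p\<close> into \<open>q ^ p\<close>, the argument required by
  the \<open>q\<close>-Chu--Vandermonde sum. The power \<open>b ^ n = (-1) ^ n q ^ (n (n + 4))\<close> in that sum is
  the source of a phase quadratic in \<open>n\<close>; half of it cancels against the phases of the remaining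
  factors.
\<close>
lemma conn_sum_square:
  fixes \<theta> :: complex
  defines "q \<equiv> exp (2 * \<i> * \<theta>)"
  assumes nz: "\<And>j. 1 \<le> j \<Longrightarrow> j \<le> n \<Longrightarrow> sin (of_nat j * \<theta>) \<noteq> 0 \<and> cos (of_nat j * \<theta>) \<noteq> 0"
  shows "conn_sum n \<theta> (q\<^sup>2) = (- \<i>) ^ n * exp (\<i> * (of_nat (n * (n + 4)) * \<theta>))
    * (\<Prod>j=1..n. sin (of_nat (j + 3) * \<theta>) / cos (of_nat j * \<theta>))"
proof -
  have q0: "q \<noteq> 0" by (simp add: q_def)
  have qp: "q ^ p = exp (2 * \<i> * (of_nat p * \<theta>))" for p
    by (simp add: q_def exp_of_nat_mult[symmetric] algebra_simps)
  \<comment> \<open>The factors of the \<open>q\<close>-factorials as a sine or a cosine times a phase.\<close>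
  have qm: "1 - 1 / q ^ p = 2 * \<i> * sin (of_nat p * \<theta>) * exp (- (\<i> * (of_nat p * \<theta>)))" for p
  proof -
    have "1 - 1 / q ^ p = 1 - exp (2 * \<i> * (- (of_nat p * \<theta>)))"
      by (simp add: qp exp_minus divide_inverse)
    then show ?thesis by (simp only: one_minus_exp) simp
  qed
  have conn: "conn_term n \<theta> p * q ^ p = qpoch q (1 / q ^ n) p * qpoch q (- (q ^ (n + 4))) p
      / (qpoch q (- q) p * qpoch q q p)" if "p \<le> n" for p
  proof -
    have "- (sin ((of_nat n - of_nat (Suc i) + 1) * \<theta>) * cos ((of_nat n + of_nat (Suc i) + 3) * \<theta>))
       / (sin (of_nat (Suc i) * \<theta>) * cos (of_nat (Suc i) * \<theta>)) * q
      = (1 - 1 / q ^ n * q ^ i) * (1 - - (q ^ (n + 4)) * q ^ i) / ((1 - - q * q ^ i) * (1 - q * q ^ i))"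
      if "i < p" for i
    proof -
      from that \<open>p \<le> n\<close> have i: "i \<le> n" by simp
      define a b c where "a = of_nat (n - i) * \<theta>" and "b = of_nat (n + i + 4) * \<theta>" and "c = of_nat (Suc i) * \<theta>"
      have "1 / q ^ n * q ^ i = 1 / q ^ (n - i)"
        using i q0 by (simp add: power_diff)
      then have 1: "1 - 1 / q ^ n * q ^ i = 2 * \<i> * sin a * exp (- (\<i> * a))"
        by (simp only: qm a_def)
      have "- (q ^ (n + 4)) * q ^ i = - exp (2 * \<i> * b)"
        unfolding b_def qp[symmetric] by (simp add: power_add)
      then have 2: "1 - - (q ^ (n + 4)) * q ^ i = 2 * cos b * exp (\<i> * b)"
        by (simp add: one_plus_exp)
      have 3: "1 - - q * q ^ i = 2 * cos c * exp (\<i> * c)" "1 - q * q ^ i = - 2 * \<i> * sin c * exp (\<i> * c)"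
        using one_plus_exp[of c] one_minus_exp[of c] qp[of "Suc i"] unfolding c_def by simp_all
      have "exp (- (\<i> * a)) * exp (\<i> * b) = exp (\<i> * c) * exp (\<i> * c) * q"
        unfolding q_def exp_add[symmetric] a_def b_def c_def
        using i by (simp add: of_nat_diff algebra_simps)
      moreover have "- (s * t) / (u * v) * q = (2 * \<i> * s * e1) * (2 * t * e2) / ((2 * v * e3) * (- 2 * \<i> * u * e3))"
        if "e1 * e2 = e3 * e3 * q" "e3 \<noteq> 0" for s t u v e1 e2 e3 :: complex
      proof -
        have "(2 * \<i> * s * e1) * (2 * t * e2) = - 4 * \<i> * (- (s * t)) * (e1 * e2)" by simp
        also have "\<dots> = (- 4 * \<i> * (e3 * e3)) * (- (s * t) * q)" unfolding that by simp
        finally have N: "(2 * \<i> * s * e1) * (2 * t * e2) = (- 4 * \<i> * (e3 * e3)) * (- (s * t) * q)" .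
        have D: "(2 * v * e3) * (- 2 * \<i> * u * e3) = (- 4 * \<i> * (e3 * e3)) * (u * v)" by simp
        show ?thesis unfolding N D using that(2) by simp
      qed
      moreover have "(of_nat n - of_nat (Suc i) + 1) * \<theta> = a" "(of_nat n + of_nat (Suc i) + 3) * \<theta> = b"
        using i by (simp_all add: a_def b_def of_nat_diff)
      ultimately show ?thesis
        unfolding 1 2 3 c_def[symmetric] by simp
    qed
    then have "(\<Prod>i<p. - (sin ((of_nat n - of_nat (Suc i) + 1) * \<theta>) * cos ((of_nat n + of_nat (Suc i) + 3) * \<theta>))
       / (sin (of_nat (Suc i) * \<theta>) * cos (of_nat (Suc i) * \<theta>)) * q)
      = (\<Prod>i<p. (1 - 1 / q ^ n * q ^ i) * (1 - - (q ^ (n + 4)) * q ^ i) / ((1 - - q * q ^ i) * (1 - q * q ^ i)))"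
      by (intro prod.cong) auto
    moreover have "(\<Prod>i<p. q) = q ^ p" by simp
    ultimately show ?thesis
      unfolding conn_term_def qpoch_def One_nat_def prod.atLeast1_atMost_eq
      by (simp only: prod.distrib prod_dividef)
  qed
  \<comment> \<open>\<open>sin (2 j \<theta>) \<noteq> 0\<close> excludes both \<open>q\<^sup>j = 1\<close> and \<open>q\<^sup>j = -1\<close>, the two degenerate cases of the
     summation formula.\<close>
  have qn1: "q ^ (2 * j) \<noteq> 1" if "1 \<le> j" "j \<le> n" for j
    using one_minus_exp[of "of_nat (2 * j) * \<theta>"] nz[OF that] sin_double[of "of_nat j * \<theta>"]
    unfolding qp by (auto simp: mult.assoc)
  have "q ^ j \<noteq> 1" if "0 < j" "j \<le> n" for j
  proof
    assume "q ^ j = 1"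
    then have "q ^ (2 * j) = 1" by (simp only: power_even_eq power_one)
    then show False using qn1[of j, OF _ that(2)] that(1) by (metis One_nat_def Suc_leI)
  qed
  moreover have "- q * q ^ j \<noteq> 1" if "j < n" for j
  proof
    assume "- q * q ^ j = 1"
    moreover have "q ^ Suc j = - (- q * q ^ j)" by simp
    ultimately have "q ^ Suc j = - 1" by (simp only:)
    then show False using qn1[of "Suc j"] that by (simp only: power_even_eq) simp
  qed
  ultimately have "(\<Sum>p\<le>n. qpoch q (1 / q ^ n) p * qpoch q (- (q ^ (n + 4))) p / (qpoch q (- q) p * qpoch q q p) * q ^ p)
    = qpoch q (- q / - (q ^ (n + 4))) n * (- (q ^ (n + 4))) ^ n / qpoch q (- q) n"
    using q0 by (intro q_chu_vandermonde) auto
  moreover have "conn_sum n \<theta> (q\<^sup>2)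
     = (\<Sum>p\<le>n. qpoch q (1 / q ^ n) p * qpoch q (- (q ^ (n + 4))) p / (qpoch q (- q) p * qpoch q q p) * q ^ p)"
    unfolding conn_sum_def
    by (intro sum.cong refl) (simp add: conn[symmetric] power_even_eq power2_eq_square power_mult_distrib)
  moreover have "qpoch q (- q / - (q ^ (n + 4))) n = (\<Prod>j<n. 1 - 1 / q ^ (j + 4))"
  proof -
    have "qpoch q (- q / - (q ^ (n + 4))) n = (\<Prod>j<n. 1 - 1 / q ^ ((n - Suc j) + 4))"
      unfolding qpoch_def
    proof (intro prod.cong refl)
      fix j assume "j \<in> {..<n}"
      then have split: "n + 4 = Suc j + ((n - Suc j) + 4)" by simp
      have "q ^ (n + 4) = q * q ^ j * q ^ ((n - Suc j) + 4)"
        by (subst split) (simp only: power_add power_Suc)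
      then show "1 - - q / - (q ^ (n + 4)) * q ^ j = 1 - 1 / q ^ ((n - Suc j) + 4)"
        using q0 by simp
    qed
    also have "\<dots> = (\<Prod>j<n. 1 - 1 / q ^ (j + 4))"
      by (rule prod.nat_diff_reindex)
    finally show ?thesis .
  qed
  ultimately have "conn_sum n \<theta> (q\<^sup>2) = (\<Prod>j<n. 1 - 1 / q ^ (j + 4)) * (- (q ^ (n + 4))) ^ n / (\<Prod>j<n. 1 - (- q) * q ^ j)"
    by (simp only: qpoch_def)
  also have "\<dots> = (\<Prod>j<n. (1 - 1 / q ^ (j + 4)) * (- (q ^ (n + 4))) / (1 - (- q) * q ^ j))"
    by (simp only: prod.distrib prod_dividef prod_constant card_lessThan)
  also have "\<dots> = (\<Prod>j<n. (- \<i>) * (exp (\<i> * (of_nat (2 * n + 3 - 2 * j) * \<theta>)) * (sin (of_nat (Suc j + 3) * \<theta>) / cos (of_nat (Suc j) * \<theta>))))"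
  proof (intro prod.cong refl)
    fix j assume "j \<in> {..<n}"
    then have j: "j < n" by simp
    define a b where "a = of_nat (j + 4) * \<theta>" and "b = of_nat (Suc j) * \<theta>"
    have 1: "1 - 1 / q ^ (j + 4) = 2 * \<i> * sin a * exp (- (\<i> * a))"
      by (simp only: qm a_def)
    have 2: "1 - (- q) * q ^ j = 2 * cos b * exp (\<i> * b)"
      using one_plus_exp[of b] qp[of "Suc j"] unfolding b_def by simp
    have 3: "exp (- (\<i> * a)) * q ^ (n + 4) = exp (\<i> * b) * exp (\<i> * (of_nat (2 * n + 3 - 2 * j) * \<theta>))"
      unfolding qp exp_add[symmetric] a_def b_def
      using j by (simp add: of_nat_diff algebra_simps)
    have "(2 * \<i> * s * e1) * (- Q) / (2 * c * e2) = - \<i> * (e3 * (s / c))" 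
      if "e1 * Q = e2 * e3" "e2 \<noteq> 0" for s c e1 e2 e3 Q :: complex
    proof -
      have "(2 * \<i> * s * e1) * (- Q) = - 2 * \<i> * s * (e1 * Q)" by simp
      also have "\<dots> = 2 * e2 * (- \<i> * e3 * s)" unfolding that(1) by simp
      finally have numer: "(2 * \<i> * s * e1) * (- Q) = 2 * e2 * (- \<i> * e3 * s)" .
      show ?thesis unfolding numer using that(2) by simp
    qed
    from this[OF 3] show "(1 - 1 / q ^ (j + 4)) * (- (q ^ (n + 4))) / (1 - (- q) * q ^ j)
       = (- \<i>) * (exp (\<i> * (of_nat (2 * n + 3 - 2 * j) * \<theta>)) * (sin (of_nat (Suc j + 3) * \<theta>) / cos (of_nat (Suc j) * \<theta>)))"
      unfolding 1 2 by (simp add: a_def b_def add_ac)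
  qed
  also have "\<dots> = (- \<i>) ^ n * (\<Prod>j<n. exp (\<i> * (of_nat (2 * n + 3 - 2 * j) * \<theta>))) * (\<Prod>j<n. sin (of_nat (Suc j + 3) * \<theta>) / cos (of_nat (Suc j) * \<theta>))"
    by (simp only: prod.distrib prod_constant card_lessThan mult.assoc)
  \<comment> \<open>Reversing the order turns the exponents into \<open>5, 7, 9, ...\<close>, with partial sums \<open>n (n + 4)\<close>.\<close>
  also have "(\<Prod>j<n. exp (\<i> * (of_nat (2 * n + 3 - 2 * j) * \<theta>))) = exp (\<i> * (of_nat (n * (n + 4)) * \<theta>))"
  proof -
    have "(\<Prod>j<n. exp (\<i> * (of_nat (2 * n + 3 - 2 * j) * \<theta>))) = (\<Prod>j<n. exp (\<i> * (of_nat (2 * (n - Suc j) + 5) * \<theta>)))"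
      by (intro prod.cong refl arg_cong[of _ _ exp] arg_cong2[of _ _ _ _ times] arg_cong[of _ _ of_nat]) auto
    also have "\<dots> = (\<Prod>j<n. exp (\<i> * (of_nat (2 * j + 5) * \<theta>)))"
      by (rule prod.nat_diff_reindex)
    also have "\<dots> = exp (\<i> * (of_nat (n * (n + 4)) * \<theta>))"
      by (induction n) (simp_all add: exp_add[symmetric] algebra_simps)
    finally show ?thesis .
  qed
  also have "(\<Prod>j<n. sin (of_nat (Suc j + 3) * \<theta>) / cos (of_nat (Suc j) * \<theta>))
     = (\<Prod>j=1..n. sin (of_nat (j + 3) * \<theta>) / cos (of_nat j * \<theta>))"
    by (simp only: One_nat_def prod.atLeast1_atMost_eq)
  finally show ?thesis .
qed

text \<open>
  Write \<open>f\<^sub>k\<close> for the sum at \<open>w = q\<^sup>k\<close>. The difference equation at \<open>x = 1, q, 1 / q\<close> is a linear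
  system in \<open>f\<^sub>-\<^sub>2, ..., f\<^sub>2\<close>, and eliminating \<open>f\<^sub>1\<close> and \<open>f\<^sub>-\<^sub>1\<close> expresses \<open>f\<^sub>0\<close> by \<open>f\<^sub>2\<close> and
  \<open>f\<^sub>-\<^sub>2\<close>. The former is known from the summation formula and the latter follows by replacing
  \<open>\<theta>\<close> with \<open>-\<theta>\<close>. They are mutually inverse phases times the same product of sines and
  cosines, so their combination is a multiple of one cosine. Its frequency is
  \<open>n (n + 4) + 3 = (n + 1) (n + 3)\<close>, where the \<open>3\<close> stems from the coefficients
  \<open>1 - q ^ 3\<close> and \<open>1 - 1 / q ^ 3\<close> of the two values.
\<close>
lemma conn_sum_closed_form:
  fixes \<theta> :: complex
  assumes nz: "\<And>j. 1 \<le> j \<Longrightarrow> j \<le> n \<Longrightarrow> sin (of_nat j * \<theta>) \<noteq> 0 \<and> cos (of_nat j * \<theta>) \<noteq> 0"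
  shows "conn_sum n \<theta> 1 * (sin (of_nat (2 * n + 2) * \<theta>) * sin (of_nat (2 * n + 6) * \<theta>))
    = 2 * sin (2 * \<theta>) * sin (3 * \<theta>)
      * (\<Prod>j=1..n. sin (of_nat (j + 3) * \<theta>) / cos (of_nat j * \<theta>))
      * cos (of_nat ((n + 1) * (n + 3)) * \<theta> - of_nat n * of_real pi / 2)"
proof -
  define u where "u = exp (\<i> * \<theta>)"
  define q where "q = exp (2 * \<i> * \<theta>)"
  define P where "P = (\<Prod>j=1..n. sin (of_nat (j + 3) * \<theta>) / cos (of_nat j * \<theta>))"
  define \<sigma> where "\<sigma> = sin ((2 * of_nat n + 4) * \<theta>)"
  define e where "e = exp (\<i> * (of_nat (n * (n + 4)) * \<theta>))"
  define f where "f = conn_sum n \<theta>"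
  have u0: "u \<noteq> 0" by (simp add: u_def)
  have qu: "q = u\<^sup>2"
    by (simp add: q_def u_def power2_eq_square exp_add[symmetric] algebra_simps)
  have q0: "q \<noteq> 0" by (simp add: q_def)
  note rec = conn_sum_recurrence[of n \<theta>, OF nz, folded q_def \<sigma>_def f_def]
  have R0: "(1 - q\<^sup>2) * f q - (1 - 1 / q\<^sup>2) * f (1 / q) = - (2 * \<i> * \<sigma>) * f 1"
    using rec[of 1] by simp
  have R1: "(1 - q ^ 3) * f (q\<^sup>2) - (1 - 1 / q) * f 1 = - (2 * \<i> * \<sigma>) * q * f q"
    using rec[of q] q0 by (simp add: power2_eq_square power3_eq_cube mult.assoc)
  have R2: "(1 - q) * f 1 - (1 - 1 / q ^ 3) * f (1 / q\<^sup>2) = - (2 * \<i> * \<sigma>) / q * f (1 / q)"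
    using rec[of "1 / q"] q0 by (simp add: power2_eq_square power3_eq_cube mult.assoc)
  have f2: "f (q\<^sup>2) = (- \<i>) ^ n * e * P"
    unfolding f_def q_def e_def P_def by (rule conn_sum_square[OF nz])
  \<comment> \<open>The terms are even in \<open>\<theta>\<close>, and \<open>-\<theta>\<close> replaces \<open>q\<close> by \<open>1 / q\<close>.\<close>
  have fm2: "f (1 / q\<^sup>2) = \<i> ^ n * (1 / e) * P"
  proof -
    have "conn_sum n (- \<theta>) ((exp (2 * \<i> * (- \<theta>)))\<^sup>2) = (- \<i>) ^ n * exp (\<i> * (of_nat (n * (n + 4)) * (- \<theta>)))
      * (\<Prod>j=1..n. sin (of_nat (j + 3) * (- \<theta>)) / cos (of_nat j * (- \<theta>)))"
      by (rule conn_sum_square) (use nz in simp)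
    moreover have "conn_sum n (- \<theta>) w = f w" for w
      by (simp add: conn_sum_def f_def conn_term_uminus)
    moreover have "(exp (2 * \<i> * (- \<theta>)))\<^sup>2 = 1 / q\<^sup>2"
      by (simp add: q_def exp_minus field_simps)
    moreover have "exp (\<i> * (of_nat (n * (n + 4)) * (- \<theta>))) = 1 / e"
      unfolding e_def mult_minus_right exp_minus by (simp add: divide_inverse)
    moreover have "(\<Prod>j=1..n. sin (of_nat (j + 3) * (- \<theta>)) / cos (of_nat j * (- \<theta>))) = (- 1) ^ n * P"
    proof -
      have "(\<Prod>j=1..n. sin (of_nat (j + 3) * (- \<theta>)) / cos (of_nat j * (- \<theta>)))
        = (\<Prod>j=1..n. (- 1) * (sin (of_nat (j + 3) * \<theta>) / cos (of_nat j * \<theta>)))"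
        by (intro prod.cong refl) (simp only: mult_minus_right sin_minus cos_minus, simp)
      then show ?thesis by (simp only: prod.distrib P_def prod_constant) simp
    qed
    ultimately have "f (1 / q\<^sup>2) = (- \<i>) ^ n * (1 / e) * ((- 1) ^ n * P)"
      by simp
    also have "\<dots> = ((- \<i>) * (- 1)) ^ n * (1 / e) * P"
      by (simp only: power_mult_distrib mult_ac)
    finally show ?thesis by simp
  qed
  have main: "f 1 * ((2 * \<i> * \<sigma>)\<^sup>2 - (q - 1 / q)\<^sup>2) = (q - 1 / q) * ((q ^ 3 - 1) * f (q\<^sup>2) + (1 - 1 / q ^ 3) * f (1 / q\<^sup>2))"
  proof -
    \<comment> \<open>Multiply the equation at \<open>x = 1\<close> by the coefficient of \<open>f 1\<close> and insert the other two.\<close>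
    have "(2 * \<i> * \<sigma>)\<^sup>2 * f 1 = - (2 * \<i> * \<sigma>) * (- (2 * \<i> * \<sigma>) * f 1)"
      by (simp add: power2_eq_square)
    also have "\<dots> = (1 - q\<^sup>2) / q * (- (2 * \<i> * \<sigma>) * q * f q) - (1 - 1 / q\<^sup>2) * q * (- (2 * \<i> * \<sigma>) / q * f (1 / q))"
    proof -
      have factor: "X / q * (- a * q * y) - Y * q * (- a / q * z) = - a * (X * y - Y * z)"
        for X Y a y z :: complex
        using q0 by (simp add: algebra_simps)
      show ?thesis unfolding R0[symmetric] by (rule factor[symmetric])
    qed
    also have "\<dots> = (1 - q\<^sup>2) / q * ((1 - q ^ 3) * f (q\<^sup>2) - (1 - 1 / q) * f 1)
        - (1 - 1 / q\<^sup>2) * q * ((1 - q) * f 1 - (1 - 1 / q ^ 3) * f (1 / q\<^sup>2))"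
      unfolding R1 R2 ..
    also have "(1 - q\<^sup>2) / q = - (q - 1 / q)"
      using q0 by (simp add: field_simps power2_eq_square)
    also have "(1 - 1 / q\<^sup>2) * q = q - 1 / q"
      using q0 by (simp add: field_simps power2_eq_square)
    finally have elim: "(2 * \<i> * \<sigma>)\<^sup>2 * f 1 = - (q - 1 / q) * ((1 - q ^ 3) * f (q\<^sup>2) - (1 - 1 / q) * f 1)
        - (q - 1 / q) * ((1 - q) * f 1 - (1 - 1 / q ^ 3) * f (1 / q\<^sup>2))" .
    have "y * (S - (q - r)\<^sup>2) = (q - r) * ((c - 1) * F + (1 - d) * G)"
      if "S * y = - (q - r) * ((1 - c) * F - (1 - r) * y) - (q - r) * ((1 - q) * y - (1 - d) * G)"
      for y S r c d F G :: complex
    proof -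
      have "y * (S - (q - r)\<^sup>2) = S * y - (q - r) * (q - r) * y"
        by (simp add: power2_eq_square algebra_simps)
      then show ?thesis unfolding that by (simp add: algebra_simps)
    qed
    from this[OF elim] show ?thesis .
  qed
  have sin2: "q - 1 / q = 2 * \<i> * sin (2 * \<theta>)"
    unfolding exp_diff_eq_sin[symmetric] by (simp add: q_def exp_minus divide_inverse mult.assoc mult.left_commute)
  \<comment> \<open>The coefficient of \<open>f 1\<close> is a difference of squares of sines and therefore factors.\<close>
  have denom: "(2 * \<i> * \<sigma>)\<^sup>2 - (2 * \<i> * sin (2 * \<theta>))\<^sup>2
      = - 4 * (sin (of_nat (2 * n + 2) * \<theta>) * sin (of_nat (2 * n + 6) * \<theta>))"
  proof -
    have s: "(sin a)\<^sup>2 - (sin b)\<^sup>2 = sin (a - b) * sin (a + b)" for a b :: complex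
    proof -
      have "sin (a - b) * sin (a + b) = (sin a)\<^sup>2 * (cos b)\<^sup>2 - (cos a)\<^sup>2 * (sin b)\<^sup>2"
        by (simp add: sin_add sin_diff power2_eq_square algebra_simps)
      then show ?thesis by (simp add: cos_squared_eq algebra_simps)
    qed
    have "(2 * of_nat n + 4) * \<theta> - 2 * \<theta> = of_nat (2 * n + 2) * \<theta>"
         "(2 * of_nat n + 4) * \<theta> + 2 * \<theta> = of_nat (2 * n + 6) * \<theta>"
      by (simp_all add: algebra_simps)
    with s[of "(2 * of_nat n + 4) * \<theta>" "2 * \<theta>"]
    have "\<sigma>\<^sup>2 - (sin (2 * \<theta>))\<^sup>2 = sin (of_nat (2 * n + 2) * \<theta>) * sin (of_nat (2 * n + 6) * \<theta>)"
      by (simp only: \<sigma>_def)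
    moreover have "(2 * \<i> * \<sigma>)\<^sup>2 - (2 * \<i> * sin (2 * \<theta>))\<^sup>2 = - 4 * (\<sigma>\<^sup>2 - (sin (2 * \<theta>))\<^sup>2)"
      by (simp add: power_mult_distrib)
    ultimately show ?thesis by (simp only:)
  qed
  have numer: "(q ^ 3 - 1) * f (q\<^sup>2) + (1 - 1 / q ^ 3) * f (1 / q\<^sup>2)
      = 2 * \<i> * sin (3 * \<theta>) * (2 * P * cos (of_nat ((n + 1) * (n + 3)) * \<theta> - of_nat n * of_real pi / 2))"
  proof -
    define \<phi> where "\<phi> = of_nat ((n + 1) * (n + 3)) * \<theta> - of_nat n * of_real pi / 2"
    have i: "\<i> ^ n = exp (\<i> * (of_nat n * of_real pi / 2))"
    proof -
      have "\<i> ^ n = exp (\<i> * of_real (pi / 2)) ^ n"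
        by (simp only: cis_conv_exp[symmetric] cis_pi_half)
      also have "\<dots> = exp (of_nat n * (\<i> * of_real (pi / 2)))"
        by (rule exp_of_nat_mult[symmetric])
      finally show ?thesis by (simp add: mult_ac)
    qed
    have iu: "(- \<i>) ^ n = 1 / \<i> ^ n"
    proof -
      have "- \<i> = 1 / \<i>" by (simp add: divide_inverse)
      then show ?thesis by (simp only: power_one_over)
    qed
    have u3: "u ^ 3 = exp (\<i> * (3 * \<theta>))"
      using exp_of_nat_mult[of 3 "\<i> * \<theta>"] by (simp add: u_def mult_ac)
    \<comment> \<open>\<open>u\<close> is a square root of \<open>q\<close>; pulling out \<open>u ^ 3 - 1 / u ^ 3\<close> leaves a sum of two
       mutually inverse phases.\<close>
    have 1: "u ^ 3 * e / \<i> ^ n = exp (\<i> * \<phi>)"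
      unfolding u3 e_def i exp_add[symmetric] exp_diff[symmetric] \<phi>_def by (simp add: algebra_simps)
    have 2: "\<i> ^ n / (u ^ 3 * e) = exp (- (\<i> * \<phi>))"
      unfolding exp_minus 1[symmetric] by simp
    have q3: "q ^ 3 = u ^ 3 * u ^ 3" by (simp add: qu power_mult_distrib power2_eq_square)
    have "(q ^ 3 - 1) * f (q\<^sup>2) + (1 - 1 / q ^ 3) * f (1 / q\<^sup>2)
       = (u ^ 3 - 1 / u ^ 3) * (u ^ 3 * e / \<i> ^ n + \<i> ^ n / (u ^ 3 * e)) * P"
    proof -
      have "(w * w - 1) * (1 / I * e * P) + (1 - 1 / (w * w)) * (I * (1 / e) * P)
          = (w - 1 / w) * (w * e / I + I / (w * e)) * P" if "w \<noteq> 0" for w I e P :: complex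
      proof -
        have "w * w - 1 = (w - 1 / w) * w" "1 - 1 / (w * w) = (w - 1 / w) * (1 / w)"
          using that by (simp_all add: left_diff_distrib diff_divide_distrib)
        then show ?thesis
          by (simp only:) (simp add: distrib_left distrib_right mult_ac)
      qed
      from this[of "u ^ 3" "\<i> ^ n" e P] show ?thesis
        unfolding f2 fm2 q3 iu using u0 by simp
    qed
    also have "u ^ 3 - 1 / u ^ 3 = 2 * \<i> * sin (3 * \<theta>)"
      unfolding exp_diff_eq_sin[symmetric] u3 exp_minus by (simp add: divide_inverse)
    also have "u ^ 3 * e / \<i> ^ n + \<i> ^ n / (u ^ 3 * e) = 2 * cos \<phi>"
      unfolding 1 2 by (simp add: cos_exp_eq)
    finally show ?thesis by (simp add: \<phi>_def)
  qed
  define R where "R = 2 * sin (2 * \<theta>) * sin (3 * \<theta>) * P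
      * cos (of_nat ((n + 1) * (n + 3)) * \<theta> - of_nat n * of_real pi / 2)"
  have "f 1 * (- 4 * (sin (of_nat (2 * n + 2) * \<theta>) * sin (of_nat (2 * n + 6) * \<theta>))) = - 4 * R"
    using main unfolding sin2 denom numer by (simp add: R_def)
  then have "- 4 * (f 1 * (sin (of_nat (2 * n + 2) * \<theta>) * sin (of_nat (2 * n + 6) * \<theta>))) = - 4 * R"
    by (simp only: mult_ac)
  then have "f 1 * (sin (of_nat (2 * n + 2) * \<theta>) * sin (of_nat (2 * n + 6) * \<theta>)) = R"
    by (subst (asm) mult_cancel_left) simp
  then show ?thesis unfolding f_def P_def R_def .
qed

section \<open>Products of a simple zero with a regular or a singular factor\<close>

lemma simple_zero_if_deriv_nonzero:
  assumes f: "f analytic_on {z}" and "f z = 0" and d: "deriv f z \<noteq> 0"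
  shows "simple_zero f z"
proof -
  have "zorder f z = 1"
    by (rule zorder_zero_eqI'[OF f]) (use assms in auto)
  moreover have "isolated_zero f z"
  proof (rule ccontr)
    assume "\<not> isolated_zero f z"
    then have "eventually (\<lambda>w. f w = 0) (nhds z)"
      using non_isolated_zero_imp_eventually_zero'[OF f] assms(2) by blast
    then have "deriv f z = deriv (\<lambda>_. 0) z"
      by (rule deriv_cong_ev) simp
    with d show False by simp
  qed
  ultimately show ?thesis
    using assms by (simp add: simple_zero_def)
qed

lemma deriv_mult_zero:
  assumes "g analytic_on {z}" "f analytic_on {z}" "f z = 0"
  shows "deriv (\<lambda>w. g w * f w) z = g z * deriv f z"
  using assms by (subst deriv_mult) (auto simp: analytic_on_imp_differentiable_at)

lemma simple_zero_remove_sings_mult: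
  assumes g: "g analytic_on {z}" "g z \<noteq> 0" and f: "f analytic_on {z}" "f z = 0" "deriv f z \<noteq> 0"
  shows "simple_zero (remove_sings (\<lambda>w. g w * f w)) z"
proof (rule simple_zero_if_deriv_nonzero)
  have a: "(\<lambda>w. g w * f w) analytic_on {z}"
    by (intro analytic_intros g f)
  show "remove_sings (\<lambda>w. g w * f w) analytic_on {z}"
    by (rule remove_sings_analytic_on[OF a])
  show "remove_sings (\<lambda>w. g w * f w) z = 0"
    using remove_sings_at_analytic[OF a] f by simp
  show "deriv (remove_sings (\<lambda>w. g w * f w)) z \<noteq> 0"
    using deriv_remove_sings_at_analytic[OF a] deriv_mult_zero[OF g(1) f(1,2)] g f by simp
qed

text \<open>
  A simple pole and a zero cancel, and \<open>h (w) f (w) / (w - z) = h (w) (f (w) - f (z)) / (w - z)\<close>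
  identifies the limit as the residue times a derivative.
\<close>
lemma simple_pole_times_zero:
  fixes h f :: "complex \<Rightarrow> complex"
  assumes h: "h analytic_on {z}" and f: "f analytic_on {z}" "f z = 0"
  defines "k \<equiv> remove_sings (\<lambda>w. h w / (w - z))"
  shows "residue k z = h z"
    and "remove_sings (\<lambda>w. k w * f w) analytic_on {z}"
    and "remove_sings (\<lambda>w. k w * f w) z = h z * deriv f z"
proof -
  obtain S where S: "open S" "z \<in> S" "h holomorphic_on S"
    using h by (auto simp: analytic_at)
  have "(\<lambda>w. h w / (w - z)) holomorphic_on (S - {z})"
    by (intro holomorphic_intros holomorphic_on_subset[OF S(3)]) auto
  then have sing: "isolated_singularity_at (\<lambda>w. h w / (w - z)) z"
    by (rule isolated_singularity_at_holomorphic) (use S in auto)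
  show "residue k z = h z"
    unfolding k_def residue_remove_sings[OF sing] by (rule residue_simple[OF S])
  have lim: "(\<lambda>w. k w * f w) \<midarrow>z\<rightarrow> h z * deriv f z"
  proof -
    have "(f has_field_derivative deriv f z) (at z)"
      using f(1) by (simp add: analytic_derivI)
    then have "(\<lambda>w. (f w - f z) / (w - z)) \<midarrow>z\<rightarrow> deriv f z"
      by (simp add: has_field_derivative_iff)
    moreover have "h \<midarrow>z\<rightarrow> h z"
      using h by (simp add: analytic_at_imp_isCont isContD)
    ultimately have "(\<lambda>w. h w * ((f w - f z) / (w - z))) \<midarrow>z\<rightarrow> h z * deriv f z"
      by (intro tendsto_mult)
    moreover have "eventually (\<lambda>w. h w * ((f w - f z) / (w - z)) = k w * f w) (at z)"
      using eventually_remove_sings_eq_at[OF sing] unfolding k_def[symmetric]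
      by eventually_elim (simp add: f)
    ultimately show ?thesis by (rule Lim_transform_eventually)
  qed
  then show "remove_sings (\<lambda>w. k w * f w) z = h z * deriv f z"
    by (rule remove_sings_eqI)
  have "isolated_singularity_at k z"
    unfolding k_def using sing by (rule isolated_singularity_at_remove_sings)
  then have "isolated_singularity_at (\<lambda>w. k w * f w) z"
    by (rule isolated_singularity_at_times[OF _ isolated_singularity_at_analytic[OF f(1)]])
  then show "remove_sings (\<lambda>w. k w * f w) analytic_on {z}"
    using lim by (rule remove_sings_analytic_at)
qed

section \<open>The simple zero of the connection factor\<close>

text \<open>
  Near \<open>q\<close> the connection factor is a function that is positive at \<open>q\<close> times
  \<open>cos ((n + 1) (n + 3) \<theta> - n \<pi> / 2)\<close>, by the closed form. At \<open>s = q\<close> the argument of the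
  cosine is \<open>\<pi> / 2 - m \<pi>\<close>, which gives both the zero and the sign of the derivative. Positivity
  holds because \<open>(n + 3) \<theta> < \<pi> / 2\<close> at \<open>s = q\<close>; this inequality is equivalent to \<open>m > 0\<close>.
\<close>
lemma F1_simple_zero:
  fixes n m :: nat and q :: real
  assumes n: "n \<ge> 2" and m: "m \<ge> 1" "2 * m < n + 1"
    and q: "q = (real n + 1 - real (2 * m)) / ((real n + 1) * (real n + 3))"
  shows "F1 n analytic_on {of_real q}" and "F1 n (of_real q) = 0"
    and "\<exists>r>0. deriv (F1 n) (of_real q) = of_real ((- 1) ^ (m + 1) * r)"
proof -
  define th where "th = (\<lambda>s::complex. of_real pi * s / 2)"
  define R where "R = (\<lambda>s. conn_sum n (th s) 1)"
  define a b where "a = 2 * n + 2" and "b = 2 * n + 6"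
  define x where "x = pi * q / 2"
  have F1: "F1 n = remove_sings R"
    unfolding F1_def R_def conn_sum_def conn_term_def rho_def Let_def th_def by simp
  have q0: "q > 0"
    using m unfolding q by (intro divide_pos_pos mult_pos_pos) auto
  have q1: "(real n + 3) * q < 1"
    using m unfolding q by (simp add: divide_less_eq)
  have x0: "x > 0" using q0 by (simp add: x_def)
  have small: "real j * x < pi / 2" if "j \<le> n + 3" for j
  proof -
    have "real j * q \<le> (real n + 3) * q"
      using that q0 by (intro mult_right_mono) auto
    then have "real j * q < 1" using q1 by linarith
    then show ?thesis
      using pi_gt_zero by (simp add: x_def field_simps)
  qed
  have thq: "of_nat j * th (of_real q) = of_real (real j * x)" for j
    by (simp add: th_def x_def)
  have sin_th: "sin (of_nat j * th (of_real q)) = of_real (sin (real j * x))"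
    and cos_th: "cos (of_nat j * th (of_real q)) = of_real (cos (real j * x))" for j
    unfolding thq by (simp_all only: sin_of_real cos_of_real)
  have sin_pos: "sin (real j * x) > 0" if "1 \<le> j" "j \<le> b" for j
  proof (rule sin_gt_zero)
    show "0 < real j * x" using that x0 by simp
    have "real j * x \<le> real (2 * (n + 3)) * x"
      using that x0 by (intro mult_right_mono) (auto simp: b_def)
    also have "\<dots> = 2 * (real (n + 3) * x)" by simp
    also have "\<dots> < pi" using small[of "n + 3"] by simp
    finally show "real j * x < pi" .
  qed
  have cos_pos: "cos (real j * x) > 0" if "j \<le> n" for j
    using small[of j] that x0 pi_gt_zero
    by (intro cos_gt_zero_pi) (auto intro: less_le_trans[of _ 0] mult_nonneg_nonneg)
  have ab: "1 \<le> a" "a \<le> b" "1 \<le> b" "1 \<le> n" "n + 3 \<le> b"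
    using n by (auto simp: a_def b_def)
  have nz: "sin (of_nat j * th (of_real q)) \<noteq> 0" "cos (of_nat j * th (of_real q)) \<noteq> 0"
    if "1 \<le> j" "j \<le> n" for j
    using sin_pos[of j] cos_pos[of j] that ab unfolding sin_th cos_th by auto
  have nz_ab: "sin (of_nat a * th (of_real q)) \<noteq> 0" "sin (of_nat b * th (of_real q)) \<noteq> 0"
    using sin_pos[of a] sin_pos[of b] ab unfolding sin_th by auto
  have th_an: "th analytic_on A" for A
    unfolding th_def by (intro analytic_intros) auto
  have R_an: "R analytic_on {of_real q}"
    unfolding R_def conn_sum_def conn_term_def
    by (intro analytic_intros th_an) (use nz in auto)
  show F1_an: "F1 n analytic_on {of_real q}"
    unfolding F1 by (rule remove_sings_analytic_on[OF R_an])
  define H where "H = (\<lambda>s. 2 * sin (of_nat 2 * th s) * sin (of_nat 3 * th s)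
      * (\<Prod>j=1..n. sin (of_nat (j + 3) * th s) / cos (of_nat j * th s))
      / (sin (of_nat (a) * th s) * sin (of_nat (b) * th s)))"
  define c where "c = (\<lambda>s. cos (of_nat ((n + 1) * (n + 3)) * th s - of_nat n * of_real pi / 2))"
  have H_an: "H analytic_on {of_real q}"
    unfolding H_def
    by (intro analytic_intros th_an) (use nz nz_ab in auto)
  have c_an: "c analytic_on {of_real q}"
    unfolding c_def by (intro analytic_intros th_an)
  have cont: "isCont (\<lambda>s. sin (of_nat j * th s)) (of_real q)" "isCont (\<lambda>s. cos (of_nat j * th s)) (of_real q)" for j
    unfolding th_def by (intro continuous_intros)+ auto
  have ev_sin: "eventually (\<lambda>s. sin (of_nat j * th s) \<noteq> 0) (nhds (of_real q))"
    if "1 \<le> j" "j \<le> b" for j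
    using cont(1)[of j] sin_pos[OF that] sin_th[of j]
    by (intro tendsto_imp_eventually_ne[of "\<lambda>s. sin (of_nat j * th s)"]) (auto simp: isCont_def tendsto_nhds_iff)
  have ev_cos: "eventually (\<lambda>s. cos (of_nat j * th s) \<noteq> 0) (nhds (of_real q))"
    if "j \<le> n" for j
    using cont(2)[of j] cos_pos[OF that] cos_th[of j]
    by (intro tendsto_imp_eventually_ne[of "\<lambda>s. cos (of_nat j * th s)"]) (auto simp: isCont_def tendsto_nhds_iff)
  have "eventually (\<lambda>s. \<forall>j\<in>{1..b}. sin (of_nat j * th s) \<noteq> 0) (nhds (of_real q))"
    by (intro eventually_ball_finite) (use ev_sin in auto)
  moreover have "eventually (\<lambda>s. \<forall>j\<in>{1..n}. cos (of_nat j * th s) \<noteq> 0) (nhds (of_real q))"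
    by (intro eventually_ball_finite) (use ev_cos in auto)
  ultimately have ev: "eventually (\<lambda>s. R s = H s * c s) (nhds (of_real q))"
  proof eventually_elim
    case (elim s)
    have "R s * (sin (of_nat (a) * th s) * sin (of_nat (b) * th s))
      = 2 * sin (of_nat 2 * th s) * sin (of_nat 3 * th s)
      * (\<Prod>j=1..n. sin (of_nat (j + 3) * th s) / cos (of_nat j * th s)) * c s"
      unfolding R_def c_def of_nat_numeral
      unfolding a_def b_def
      by (rule conn_sum_closed_form) (use elim ab in auto)
    moreover have "sin (of_nat (a) * th s) \<noteq> 0" "sin (of_nat (b) * th s) \<noteq> 0"
      using elim(1) ab by auto
    ultimately show ?case
      unfolding H_def by (simp add: divide_simps del: of_nat_numeral)
  qed
  define r where "r = 2 * sin (real 2 * x) * sin (real 3 * x)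
      * (\<Prod>j=1..n. sin (real (j + 3) * x) / cos (real j * x))
      / (sin (real (a) * x) * sin (real (b) * x))"
  have Hq: "H (of_real q) = of_real r"
    unfolding H_def r_def sin_th cos_th by simp
  have r0: "r > 0"
    unfolding r_def using n ab
    by (intro divide_pos_pos mult_pos_pos prod_pos sin_pos cos_pos ballI) auto
  have arg: "of_nat ((n + 1) * (n + 3)) * th (of_real q) - of_nat n * of_real pi / 2
      = complex_of_real (pi / 2 - real m * pi)"
  proof -
    have "real ((n + 1) * (n + 3)) * x = pi * (real n + 1 - real (2 * m)) / 2"
    proof -
      have "(real n + 1) * (real n + 3) \<noteq> 0" by auto
      then have "(real n + 1) * (real n + 3) * q = real n + 1 - real (2 * m)"
        unfolding q times_divide_eq_right by (rule nonzero_mult_div_cancel_left)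
      moreover have "real ((n + 1) * (n + 3)) * x = pi * ((real n + 1) * (real n + 3) * q) / 2"
        unfolding x_def by (simp add: algebra_simps)
      ultimately show ?thesis by (simp only:)
    qed
    then have "real ((n + 1) * (n + 3)) * x - real n * pi / 2 = pi / 2 - real m * pi"
      by (simp add: field_simps)
    moreover have "of_real y - of_nat n * of_real pi / 2 = complex_of_real (y - real n * pi / 2)" for y
      by simp
    ultimately show ?thesis
      unfolding thq by (simp only:)
  qed
  have cq: "c (of_real q) = 0"
    unfolding c_def arg cos_of_real by (simp add: cos_diff)
  have dc: "deriv c (of_real q) = of_real ((- 1) ^ (m + 1) * (real ((n + 1) * (n + 3)) * pi / 2))"
  proof -
    have "(c has_field_derivative - sin (of_nat ((n + 1) * (n + 3)) * th (of_real q) - of_nat n * of_real pi / 2)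
        * (of_nat ((n + 1) * (n + 3)) * (of_real pi / 2))) (at (of_real q))"
      unfolding c_def th_def by (auto intro!: derivative_eq_intros)
    then have "deriv c (of_real q) = - sin (of_nat ((n + 1) * (n + 3)) * th (of_real q) - of_nat n * of_real pi / 2)
        * (of_nat ((n + 1) * (n + 3)) * (of_real pi / 2))"
      by (rule DERIV_imp_deriv)
    also have "\<dots> = of_real (- sin (pi / 2 - real m * pi) * (real ((n + 1) * (n + 3)) * (pi / 2)))"
      unfolding arg sin_of_real by simp
    also have "sin (pi / 2 - real m * pi) = (- 1) ^ m"
      by (simp add: sin_diff)
    finally show ?thesis by simp
  qed
  have "F1 n (of_real q) = R (of_real q)"
    unfolding F1 using R_an by simp
  also have "\<dots> = 0"
    using eventually_nhds_x_imp_x[OF ev] cq by simp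
  finally show "F1 n (of_real q) = 0" .
  have "deriv (F1 n) (of_real q) = deriv R (of_real q)"
    unfolding F1 using R_an by simp
  also have "\<dots> = deriv (\<lambda>s. H s * c s) (of_real q)"
    using ev by (rule deriv_cong_ev) simp
  also have "\<dots> = of_real ((- 1) ^ (m + 1) * (r * (real ((n + 1) * (n + 3)) * pi / 2)))"
    unfolding deriv_mult_zero[OF H_an c_an cq] Hq dc by simp
  finally show "\<exists>r>0. deriv (F1 n) (of_real q) = of_real ((- 1) ^ (m + 1) * r)"
  proof (intro exI conjI)
    have "real ((n + 1) * (n + 3)) > 0" by (simp only: of_nat_0_less_iff) simp
    then show "r * (real ((n + 1) * (n + 3)) * pi / 2) > 0"
      using r0 by (intro mult_pos_pos divide_pos_pos) auto
  qed
qed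

section \<open>The reference period at the zero of the connection factor\<close>

text \<open>
  With the conventions \<open>Gamma z = 0\<close> at the poles and \<open>x / 0 = 0\<close> this holds at every point,
  which makes the factorisation of \<^const>\<open>K0\<close> at its pole an identity of total functions.
\<close>
lemma Gamma_eq_divide: "Gamma z = Gamma (z + 1) / z" for z :: complex
  unfolding Gamma_def using rGamma_plus1[of z] by (metis divide_inverse inverse_mult_distrib mult.commute)

lemma of_real_pos_not_nonpos_Int: "x > 0 \<Longrightarrow> complex_of_real x \<notin> \<int>\<^sub>\<le>\<^sub>0"
  by (metis of_real_in_nonpos_Ints_iff nonpos_Ints_nonpos not_le)

text \<open>
  The argument of the \<open>j\<close>-th factor \<open>\<Gamma>(a + j c)\<close> of the Selberg product on the given line. These
  are the only Gamma factors whose arguments can leave the positive axis for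
  \<open>0 < s < 1 / (n + 3)\<close>; the others are collected in \<open>K0_rest\<close>.
\<close>
definition K0_arg :: "nat \<Rightarrow> nat \<Rightarrow> complex \<Rightarrow> complex" where
  "K0_arg n j s = (of_nat (2 * n + 3 - j) * s - 1) / 2"

definition K0_rest :: "nat \<Rightarrow> complex \<Rightarrow> complex" where
  "K0_rest n s = 1 / fact n * (\<Prod>j<n. Gamma (1 - of_nat (j + 4) * s / 2) * Gamma (1 - of_nat (j + 1) * s / 2)
     / (Gamma (1 / 2 + of_nat (n - j) * s / 2) * Gamma (1 - s / 2)))"

lemma K0_eq: "K0 n = remove_sings (\<lambda>s. (\<Prod>j<n. Gamma (K0_arg n j s)) * K0_rest n s)"
proof -
  have "1 / fact n * selberg_product n (- 1 / 2 + (of_nat n + 3 / 2) * s) (1 - 2 * s) (- s / 2)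
      = (\<Prod>j<n. Gamma (K0_arg n j s)) * K0_rest n s" for s
  proof -
    have selberg: "selberg_product n (- 1 / 2 + (of_nat n + 3 / 2) * s) (1 - 2 * s) (- s / 2)
      = (\<Prod>j<n. Gamma (K0_arg n j s) * (Gamma (1 - of_nat (j + 4) * s / 2) * Gamma (1 - of_nat (j + 1) * s / 2)
     / (Gamma (1 / 2 + of_nat (n - j) * s / 2) * Gamma (1 - s / 2))))"
      unfolding selberg_product_def
    proof (intro prod.cong refl)
      fix j assume "j \<in> {..<n}"
      then have j: "j < n" by simp
      have 1: "- 1 / 2 + (of_nat n + 3 / 2) * s + of_nat j * (- s / 2) = K0_arg n j s"
        using j unfolding K0_arg_def by (simp add: of_nat_diff field_simps)
      have 2: "1 - 2 * s + of_nat j * (- s / 2) = 1 - of_nat (j + 4) * s / 2"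
        by (simp add: field_simps)
      have 3: "1 + of_nat (j + 1) * (- s / 2) = 1 - of_nat (j + 1) * s / 2"
        by (simp add: field_simps)
      have 4: "- 1 / 2 + (of_nat n + 3 / 2) * s + (1 - 2 * s) + (of_nat n + of_nat j - 1) * (- s / 2)
          = 1 / 2 + of_nat (n - j) * s / 2"
        using j by (simp add: of_nat_diff field_simps)
      have 5: "1 + (- s / 2) = 1 - s / 2" by simp
      show "Gamma (- 1 / 2 + (of_nat n + 3 / 2) * s + of_nat j * (- s / 2)) * Gamma (1 - 2 * s + of_nat j * (- s / 2))
          * Gamma (1 + of_nat (j + 1) * (- s / 2))
        / (Gamma (- 1 / 2 + (of_nat n + 3 / 2) * s + (1 - 2 * s) + (of_nat n + of_nat j - 1) * (- s / 2)) * Gamma (1 + - s / 2))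
        = Gamma (K0_arg n j s) * (Gamma (1 - of_nat (j + 4) * s / 2) * Gamma (1 - of_nat (j + 1) * s / 2)
     / (Gamma (1 / 2 + of_nat (n - j) * s / 2) * Gamma (1 - s / 2)))"
        unfolding 1 2 3 4 5 by simp
    qed
    show ?thesis
      unfolding selberg prod.distrib K0_rest_def by (simp only: mult.left_commute)
  qed
  then show ?thesis by (simp add: K0_def)
qed

lemma K0_rest_regular:
  fixes q :: real
  assumes q: "q > 0" "(real n + 3) * q < 1"
  shows "K0_rest n analytic_on {of_real q}" and "\<exists>r>0. K0_rest n (of_real q) = of_real r"
proof -
  define u where "u = (\<lambda>j. 1 - real (j + 4) * q / 2)"
  define v where "v = (\<lambda>j. 1 - real (j + 1) * q / 2)"
  define w where "w = (\<lambda>j. 1 / 2 + real (n - j) * q / 2)"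
  define t where "t = 1 - q / 2"
  have bound: "real i * q < 1" if "i \<le> n + 3" for i
  proof -
    have "real i * q \<le> (real n + 3) * q"
      using that q by (intro mult_right_mono) auto
    then show ?thesis using q by linarith
  qed
  have u: "u j > 0" and v: "v j > 0" if "j < n" for j
    using bound[of "j + 4"] bound[of "j + 1"] that unfolding u_def v_def by auto
  have w: "w j > 0" for j
    using q by (auto simp: w_def intro!: add_pos_nonneg)
  have t: "t > 0"
    using bound[of 1] by (simp add: t_def)
  have eqs: "1 - of_nat (j + 4) * complex_of_real q / 2 = of_real (u j)"
    "1 - of_nat (j + 1) * complex_of_real q / 2 = of_real (v j)"
    "1 / 2 + of_nat (n - j) * complex_of_real q / 2 = of_real (w j)"
    "1 - complex_of_real q / 2 = of_real t" for j
    by (simp_all add: u_def v_def w_def t_def)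
  show "K0_rest n analytic_on {of_real q}"
    unfolding K0_rest_def[abs_def]
  proof (intro analytic_intros ballI)
    fix j s assume "j \<in> {..<n}" and s: "s \<in> {complex_of_real q}"
    then have j: "j < n" by simp
    note pos = u[OF j] v[OF j] w[of j] t
    note ni = pos[THEN of_real_pos_not_nonpos_Int]
    from s have s: "s = of_real q" by simp
    show "1 - of_nat (j + 4) * s / 2 \<notin> \<int>\<^sub>\<le>\<^sub>0" "1 - of_nat (j + 1) * s / 2 \<notin> \<int>\<^sub>\<le>\<^sub>0"
      "1 / 2 + of_nat (n - j) * s / 2 \<notin> \<int>\<^sub>\<le>\<^sub>0" "1 - s / 2 \<notin> \<int>\<^sub>\<le>\<^sub>0"
      unfolding s eqs by (fact ni)+
    show "Gamma (1 / 2 + of_nat (n - j) * s / 2) * Gamma (1 - s / 2) \<noteq> 0"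
      unfolding s eqs using ni by (simp add: Gamma_eq_zero_iff)
  qed auto
  have "K0_rest n (of_real q) = of_real (1 / fact n * (\<Prod>j<n. Gamma (u j) * Gamma (v j) / (Gamma (w j) * Gamma t)))"
    unfolding K0_rest_def eqs Gamma_complex_of_real by simp
  moreover have "1 / fact n * (\<Prod>j<n. Gamma (u j) * Gamma (v j) / (Gamma (w j) * Gamma t)) > 0"
    by (intro mult_pos_pos prod_pos ballI divide_pos_pos Gamma_real_pos) (use u v w t in auto)
  ultimately show "\<exists>r>0. K0_rest n (of_real q) = of_real r" by blast
qed

text \<open>
  The arguments lie strictly between \<open>-1 / 2\<close> and \<open>1 / 2\<close>, so \<open>0\<close> is the only pole of the Gamma
  function that they can meet.
\<close>
lemma K0_arg_of_real:
  assumes "j < n" "q > 0" "(real n + 3) * q < 1"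
  shows "K0_arg n j (of_real q) = of_real ((real (2 * n + 3 - j) * q - 1) / 2)"
    and "(real (2 * n + 3 - j) * q - 1) / 2 > - 1 / 2" and "(real (2 * n + 3 - j) * q - 1) / 2 < 1 / 2"
proof -
  show "K0_arg n j (of_real q) = of_real ((real (2 * n + 3 - j) * q - 1) / 2)"
    by (simp add: K0_arg_def)
  show "(real (2 * n + 3 - j) * q - 1) / 2 > - 1 / 2"
    using assms by simp
  have "real (2 * n + 3 - j) * q \<le> (2 * (real n + 3)) * q"
    using assms by (intro mult_right_mono) auto
  also have "\<dots> = 2 * ((real n + 3) * q)" by simp
  also have "\<dots> < 2" using assms(3) by simp
  finally have "real (2 * n + 3 - j) * q < 2" .
  moreover have "(y - 1) / 2 < 1 / 2" if "y < 2" for y :: real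
    using that by simp
  ultimately show "(real (2 * n + 3 - j) * q - 1) / 2 < 1 / 2" by blast
qed

lemma Gamma_neg:
  fixes x :: real assumes "- 1 < x" "x < 0" shows "Gamma x < 0"
proof -
  have "x \<notin> \<int>\<^sub>\<le>\<^sub>0"
  proof
    assume "x \<in> \<int>\<^sub>\<le>\<^sub>0"
    then obtain i where "x = of_int i" by (auto simp: nonpos_Ints_def)
    with assms show False by auto
  qed
  then have "Gamma (x + 1) = x * Gamma x" by (rule Gamma_plus1)
  moreover have "Gamma (x + 1) > 0" using assms by simp
  ultimately show ?thesis using assms by (simp add: zero_less_mult_iff)
qed

text \<open>
  Here every Gamma factor is finite, and \<open>\<Gamma>\<close> has no zeros.
\<close>
lemma K0_nonpole:
  fixes q :: real
  assumes q: "q > 0" "(real n + 3) * q < 1" and np: "\<And>j. j < n \<Longrightarrow> real (2 * n + 3 - j) * q \<noteq> 1"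
  shows "K0 n analytic_on {of_real q}" and "K0 n (of_real q) \<noteq> 0"
proof -
  let ?G = "\<lambda>s. (\<Prod>j<n. Gamma (K0_arg n j s)) * K0_rest n s"
  have ni: "K0_arg n j (of_real q) \<notin> \<int>\<^sub>\<le>\<^sub>0" if "j < n" for j
  proof -
    define x where "x = (real (2 * n + 3 - j) * q - 1) / 2"
    have "- 1 / 2 < x" "x < 1 / 2"
      unfolding x_def by (rule K0_arg_of_real(2,3)[OF that q])+
    moreover have "x \<noteq> 0"
    proof
      assume "x = 0"
      moreover have "y = 1" if "(y - 1) / 2 = 0" for y :: real
        using that by simp
      ultimately have "real (2 * n + 3 - j) * q = 1"
        unfolding x_def by blast
      with np[OF that] show False ..
    qed
    ultimately have "x \<notin> \<int>\<^sub>\<le>\<^sub>0" by (auto simp: nonpos_Ints_def)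
    then show ?thesis
      unfolding K0_arg_of_real(1)[OF that q] x_def[symmetric] by (simp add: of_real_in_nonpos_Ints_iff)
  qed
  have an: "?G analytic_on {of_real q}"
    using ni unfolding K0_arg_def by (intro analytic_intros K0_rest_regular q ballI) auto
  show "K0 n analytic_on {of_real q}"
    unfolding K0_eq by (rule remove_sings_analytic_on[OF an])
  have "?G (of_real q) \<noteq> 0"
    using ni K0_rest_regular(2)[OF q] by (auto simp: Gamma_eq_zero_iff)
  then show "K0 n (of_real q) \<noteq> 0"
    unfolding K0_eq using remove_sings_at_analytic[OF an] by simp
qed

text \<open>
  The arguments decrease in \<open>j\<close>. If the one with index \<open>i\<close> vanishes, the factors with smaller index
  are therefore positive, and each of the \<open>n - 1 - i\<close> factors with larger index is \<open>\<Gamma>\<close> at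
  a point of \<open>(-1 / 2, 0)\<close>, hence negative. The vanishing argument is a positive multiple of
  \<open>s - q\<close>, so it contributes a simple pole with positive residue.
\<close>
lemma K0_simple_pole:
  fixes q :: real
  assumes q: "q > 0" "(real n + 3) * q < 1" and i: "i < n" "real (2 * n + 3 - i) * q = 1"
  shows "\<exists>h r. h analytic_on {of_real q} \<and> K0 n = remove_sings (\<lambda>s. h s / (s - of_real q))
    \<and> r > 0 \<and> h (of_real q) = of_real ((- 1) ^ (n - 1 - i) * r)"
proof -
  define N where "N = 2 * n + 3 - i"
  define g where "g = (\<lambda>j. Gamma ((real (2 * n + 3 - j) * q - 1) / 2))"
  define h where "h = (\<lambda>s. 2 / of_nat N * Gamma (K0_arg n i s + 1)
      * (\<Prod>j\<in>{..<n} - {i}. Gamma (K0_arg n j s)) * K0_rest n s)"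
  have N: "N > 0" using i by (simp add: N_def)
  have arg_i: "K0_arg n i s = of_nat N * (s - of_real q) / 2" for s
  proof -
    have "of_nat N * complex_of_real q = 1"
      using i(2) unfolding N_def[symmetric] by (metis of_real_1 of_real_mult of_real_of_nat_eq)
    then show ?thesis
      unfolding K0_arg_def N_def[symmetric] by (simp add: right_diff_distrib)
  qed
  have "(\<Prod>j<n. Gamma (K0_arg n j s)) * K0_rest n s = h s / (s - of_real q)" for s
  proof -
    have "(\<Prod>j<n. Gamma (K0_arg n j s)) = Gamma (K0_arg n i s) * (\<Prod>j\<in>{..<n} - {i}. Gamma (K0_arg n j s))"
      using i by (intro prod.remove) auto
    also have "Gamma (K0_arg n i s) = Gamma (K0_arg n i s + 1) / (of_nat N * (s - of_real q) / 2)"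
      using Gamma_eq_divide[of "K0_arg n i s"] arg_i[of s] by metis
    finally show ?thesis by (simp add: h_def)
  qed
  then have K0: "K0 n = remove_sings (\<lambda>s. h s / (s - of_real q))"
    unfolding K0_eq by simp
  have other: "real (2 * n + 3 - j) * q < 1 \<longleftrightarrow> i < j" "real (2 * n + 3 - j) * q > 1 \<longleftrightarrow> j < i"
    if "j < n" for j
  proof -
    have "real (2 * n + 3 - j) * q - 1 = (real i - real j) * q"
      using i that by (simp add: of_nat_diff algebra_simps)
    then show "real (2 * n + 3 - j) * q < 1 \<longleftrightarrow> i < j" "real (2 * n + 3 - j) * q > 1 \<longleftrightarrow> j < i"
      using q(1) by (smt (verit) mult_less_0_iff of_nat_less_iff zero_less_mult_iff)+
  qed
  have g_pos: "g j > 0" if "j < i" for j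
    unfolding g_def using other(2)[of j] that i by (intro Gamma_real_pos) simp
  have g_neg: "g j < 0" if "i < j" "j < n" for j
    unfolding g_def using other(1)[of j] K0_arg_of_real(2)[OF that(2) q] that by (intro Gamma_neg) auto
  have g: "Gamma (K0_arg n j (of_real q)) = of_real (g j)" if "j < n" for j
    unfolding K0_arg_of_real(1)[OF that q] g_def by (rule Gamma_complex_of_real)
  have ni: "K0_arg n j (of_real q) \<notin> \<int>\<^sub>\<le>\<^sub>0" if "j < n" "j \<noteq> i" for j
  proof -
    have "g j \<noteq> 0" using g_pos[of j] g_neg[of j] that by (cases "j < i") auto
    then show ?thesis using g[OF that(1)] by (metis Gamma_eq_zero_iff of_real_eq_0_iff)
  qed
  have "K0_arg n i (of_real q) + 1 = 1" by (simp add: arg_i)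
  then have ni': "K0_arg n i (of_real q) + 1 \<notin> \<int>\<^sub>\<le>\<^sub>0" by simp
  have h_an: "h analytic_on {of_real q}"
    using ni ni' N unfolding h_def K0_arg_def by (intro analytic_intros K0_rest_regular q ballI) auto
  obtain r where r: "r > 0" "K0_rest n (of_real q) = of_real r"
    using K0_rest_regular(2)[OF q] by blast
  have "h (of_real q) = of_real (2 / real N * (\<Prod>j\<in>{..<n} - {i}. g j) * r)"
    unfolding h_def r arg_i by (simp add: g)
  also have "(\<Prod>j\<in>{..<n} - {i}. g j) = (\<Prod>j\<in>{..<n} - {i}. (if i < j then - 1 else 1) * \<bar>g j\<bar>)"
  proof (intro prod.cong refl)
    fix j assume "j \<in> {..<n} - {i}"
    then show "g j = (if i < j then - 1 else 1) * \<bar>g j\<bar>"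
      using g_pos[of j] g_neg[of j] by (cases "i < j") auto
  qed
  also have "\<dots> = (\<Prod>j\<in>{..<n} - {i}. if i < j then - 1 else 1) * (\<Prod>j\<in>{..<n} - {i}. \<bar>g j\<bar>)"
    by (rule prod.distrib)
  also have "(\<Prod>j\<in>{..<n} - {i}. if i < j then - 1 else 1) = (- 1 :: real) ^ (n - 1 - i)"
  proof -
    have "({..<n} - {i}) \<inter> {j. i < j} = {i<..<n}" using i by auto
    then show ?thesis by (simp add: prod.If_cases)
  qed
  finally have "h (of_real q) = of_real ((- 1) ^ (n - 1 - i) * (2 / real N * (\<Prod>j\<in>{..<n} - {i}. \<bar>g j\<bar>) * r))"
    by (simp add: mult_ac)
  moreover have "2 / real N * (\<Prod>j\<in>{..<n} - {i}. \<bar>g j\<bar>) * r > 0"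
  proof -
    have "(\<Prod>j\<in>{..<n} - {i}. \<bar>g j\<bar>) > 0"
    proof (intro prod_pos)
      fix j assume "j \<in> {..<n} - {i}"
      then show "\<bar>g j\<bar> > 0"
        using g_pos[of j] g_neg[of j] by (cases "i < j") auto
    qed
    then show ?thesis using N r by simp
  qed
  ultimately show ?thesis using h_an K0 by blast
qed

theorem theorem6p3:
  fixes n l m :: nat and M q k :: real
  assumes "n \<ge> 2" and "l = 2 * m" and "2 \<le> l" and "l < n + 1"
    and "M = (real n + 1) * (real n + 3)"
    and "q = (real n + 1 - real l) / M"
    and "k = 1 / q"
  shows "simple_zero (F1 n) (of_real q)
    \<and> Kn n analytic_on {of_real q}
    \<and> (Kn n (of_real q) \<noteq> 0 \<longleftrightarrow> k \<in> \<int> \<and> real n + 4 \<le> k \<and> k \<le> 2 * real n + 3)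
    \<and> (k \<in> \<int> \<and> real n + 4 \<le> k \<and> k \<le> 2 * real n + 3 \<longrightarrow>
         (\<forall>j0 :: int. of_int j0 = 2 * real n + 3 - k \<longrightarrow>
            Kn n (of_real q) = residue (K0 n) (of_real q) * deriv (F1 n) (of_real q)
          \<and> sgn (Kn n (of_real q)) = (- 1) powi (int n - j0 + int m)))
    \<and> (\<not> (k \<in> \<int> \<and> real n + 4 \<le> k \<and> k \<le> 2 * real n + 3) \<longrightarrow>
         simple_zero (Kn n) (of_real q))"
proof -
  let ?z = "complex_of_real q"
  let ?C = "k \<in> \<int> \<and> real n + 4 \<le> k \<and> k \<le> 2 * real n + 3"
  have m: "m \<ge> 1" "2 * m < n + 1" using assms by auto
  have q: "q = (real n + 1 - real (2 * m)) / ((real n + 1) * (real n + 3))"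
    using assms by simp
  have q0: "q > 0"
    using m unfolding q by (intro divide_pos_pos mult_pos_pos) auto
  have q1: "(real n + 3) * q < 1"
    using m unfolding q by (simp add: divide_less_eq)
  note F1 = F1_simple_zero[OF assms(1) m q]
  obtain d where d: "d > 0" "deriv (F1 n) ?z = of_real ((- 1) ^ (m + 1) * d)"
    using F1(3) by blast
  have d0: "deriv (F1 n) ?z \<noteq> 0" using d by simp
  have F1_zero: "simple_zero (F1 n) ?z"
    by (rule simple_zero_if_deriv_nonzero[OF F1(1,2) d0])
  \<comment> \<open>The pole condition \<open>(2 n + 3 - j) q = 1\<close> for some \<open>j < n\<close> says that \<open>k\<close> is one of the
     integers \<open>n + 4, ..., 2 n + 3\<close>.\<close>
  have kq: "x * q = 1 \<longleftrightarrow> x = k" for x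
    unfolding assms(7) using q0 by (simp add: eq_divide_eq)
  show ?thesis
  proof (cases ?C)
    case False
    have "real (2 * n + 3 - j) * q \<noteq> 1" if "j < n" for j
    proof
      assume "real (2 * n + 3 - j) * q = 1"
      then have "real (2 * n + 3 - j) = k" by (simp only: kq)
      with that have "?C" by (auto simp: of_nat_diff)
      with False show False ..
    qed
    note K0 = K0_nonpole[OF q0 q1 this]
    have "simple_zero (Kn n) ?z"
      unfolding Kn_def by (rule simple_zero_remove_sings_mult[OF K0 F1(1,2) d0])
    with False F1_zero show ?thesis
      by (auto simp: simple_zero_def)
  next
    case True
    then obtain K :: int where K: "k = of_int K" by (auto elim: Ints_cases)
    define i where "i = nat (2 * int n + 3 - K)"
    have Kb: "int n + 4 \<le> K" "K \<le> 2 * int n + 3"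
      using True unfolding K by linarith+
    then have i: "i < n" "int i = 2 * int n + 3 - K"
      by (auto simp: i_def)
    have "int (2 * n + 3 - i) = K" using i by linarith
    then have "real (2 * n + 3 - i) = k" unfolding K by (metis of_int_of_nat_eq)
    then have "real (2 * n + 3 - i) * q = 1" by (simp only: kq)
    from K0_simple_pole[OF q0 q1 i(1) this] obtain h r where
      h: "h analytic_on {?z}" "K0 n = remove_sings (\<lambda>s. h s / (s - ?z))"
      and r: "r > 0" "h ?z = of_real ((- 1) ^ (n - 1 - i) * r)"
      by blast
    note pole = simple_pole_times_zero[OF h(1) F1(1,2), folded h(2), folded Kn_def]
    have val: "Kn n ?z = residue (K0 n) ?z * deriv (F1 n) ?z"
      unfolding pole(1,3) ..
    have Kn: "Kn n ?z = of_real ((- 1) ^ (n - 1 - i + (m + 1)) * (r * d))"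
      unfolding pole(3) r(2) d(2) by (simp add: power_add mult_ac)
    have "sgn (Kn n ?z) = of_real (sgn ((- 1) ^ (n - 1 - i + (m + 1)) * (r * d)))"
      unfolding Kn by (rule sgn_of_real)
    also have "sgn ((- 1) ^ (n - 1 - i + (m + 1)) * (r * d)) = (- 1) ^ (n - 1 - i + (m + 1))"
      using r d by (simp add: sgn_mult power_sgn[symmetric])
    finally have sgn: "sgn (Kn n ?z) = (- 1) ^ (n - 1 - i + (m + 1))" by simp
    have "(- 1) powi (int n - j0 + int m) = (- 1 :: complex) ^ (n - 1 - i + (m + 1))"
      if "of_int j0 = 2 * real n + 3 - k" for j0
    proof -
      have "j0 = 2 * int n + 3 - K" using that unfolding K by linarith
      then have "int n - j0 + int m = int (n - 1 - i + (m + 1))" using i by linarith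
      then show ?thesis by (simp only: power_int_of_nat)
    qed
    moreover have "Kn n ?z \<noteq> 0" unfolding Kn using r d by simp
    ultimately show ?thesis
      using True F1_zero pole(2) val sgn by auto
  qed
qed

end
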